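(* Let $g_1,\dots,g_\ell$ be signomial terms in $x\in\mathbb{R}^n_{++}$, and let $\mathcal{S}_{\mathrm{lift}}=\{(x,y)\in\mathbb{R}^{n+\ell}_{++}: y_i=g_i(x)\ \text{for all } i\in[\ell]\}$ be the signomial lift. Fix $i\in[\ell]$ with $g_i=\psi_\alpha$, let $(u,v)$ and $(\beta,\gamma)$ be the variables and exponents of a normalized DCC formulation (so $\max(\lVert\beta\rVert_1,\lVert\gamma\rVert_1)=1$) of the epigraph or the hypograph of the reduced signomial term of $g_i$, with $u\in\mathbb{R}^h$ and $v\in\mathbb{R}^k$, let $\tilde v\in\mathbb{R}^k_{++}$, and let $$\mathcal{C}=\{(u,v)\in\mathbb{R}^h_+\times\mathbb{R}^k:\psi_\beta(u)-\Xi^{\psi_\gamma}_{\tilde v}(v)\ge 0\}.$$ Then the orthogonal lifting of $\mathcal{C}$ with respect to $g_i$ is a maximal $\mathcal{S}_{\mathrm{lift}}$-free set in the nonnegative orthant $\mathbb{R}_+^{n+\ell}$.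
   Context: A signomial term is a function $\psi_\alpha(x)=x^\alpha=\prod_{j}x_j^{\alpha_j}$ with real exponent vector $\alpha$ (an empty product is $1$). For differentiable $f$, $\Xi^{f}_{\tilde x}(x):=f(\tilde x)+\nabla f(\tilde x)\cdot(x-\tilde x)$ (the affine function $\Xi^{\psi_\gamma}_{\tilde v}$ is considered on all of $\mathbb{R}^k$). Reduced term and normalized DCC formulation: let $g_i=\psi_\alpha$, $J_-=\{j:\alpha_j<0\}$, $J_+=\{j:\alpha_j>0\}$, $J_i=J_-\cup J_+$, $x_-=x_{J_-}$, $x_+=x_{J_+}$, $\alpha_-=\alpha_{J_-}$, $\alpha_+=\alpha_{J_+}$, $t=y_i$. The reduced term is $g_i'(x_{J_i})=x_-^{\alpha_-}x_+^{\alpha_+}$. The signomial-term set is its hypograph $t\le x_-^{\alpha_-}x_+^{\alpha_+}$ or epigraph $t\ge x_-^{\alpha_-}x_+^{\alpha_+}$; on nonnegative variables (after clearing negative exponents and taking the closure) it is written $\psi_\beta(u)-\psi_\gamma(v)\le 0$, where for some scaling $\mu>0$: for the hypograph, $u=(t,x_-)$, $v=x_+$, $\beta=\mu(1,-\alpha_-)$, $\gamma=\mu\alpha_+$; for the epigraph (roles exchanged), $u=x_+$, $v=(t,x_-)$, $\beta=\mu\alpha_+$, $\gamma=\mu(1,-\alpha_-)$. The formulation is called normalized DCC when $\mu$ is chosen such that $\max(\lVert\beta\rVert_1,\lVert\gamma\rVert_1)=1$. Orthogonal lifting: let $I_i=J_i\cup\{n+i\}$ and $I_i^c=[n+\ell]\smallsetminus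 I_i$. The orthogonal lifting of $\mathcal{C}$ w.r.t. $g_i$ is $\mathcal{C}\times\mathbb{R}^{I_i^c}$, i.e. the set of all $(x,y)\in\mathbb{R}^{n+\ell}$ whose sub-vector $(x_{J_i},y_i)$, rearranged as $(u,v)$, lies in $\mathcal{C}$. Given $\mathcal{S}\subsetneq\mathbb{R}^p$, a closed set $\mathcal{C}\subseteq\mathbb{R}^p$ is $\mathcal{S}$-free if $\mathcal{C}$ is convex and $\mathrm{int}(\mathcal{C})\cap\mathcal{S}=\varnothing$. Given a closed convex set $\mathcal{G}\subseteq\mathbb{R}^p$ with $\mathcal{S}\subsetneq\mathcal{G}$, an $\mathcal{S}$-free set $\mathcal{C}$ is maximal in $\mathcal{G}$ if there is no other $\mathcal{S}$-free set $\mathcal{C}'$ such that $\mathcal{C}\cap\mathcal{G}\subsetneq\mathcal{C}'\cap\mathcal{G}$. *)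

theory Defs
  imports "HOL-Analysis.Analysis"
begin

text \<open>
  Vectors whose dimension depends on the data are indexed by a finite set \<open>J\<close> of coordinate
  labels: \<open>\<real>\<^sup>J\<close> is the set \<open>J \<rightarrow>\<^sub>E UNIV\<close> of extensional functions (a single point if
  \<open>J = {}\<close>), so that a sub-vector keeps the labels of its coordinates.
\<close>

definition signomial_term :: "'j set \<Rightarrow> ('j \<Rightarrow> real) \<Rightarrow> ('j \<Rightarrow> real) \<Rightarrow> real" where
  "signomial_term J a x = (\<Prod>j\<in>J. x j powr a j)"

definition l1_norm :: "'j set \<Rightarrow> ('j \<Rightarrow> real) \<Rightarrow> real" where
  "l1_norm J a = (\<Sum>j\<in>J. \<bar>a j\<bar>)"

text \<open>The affine function \<open>x \<mapsto> f(w) + \<nabla>f(w) \<cdot> (x - w)\<close> on \<open>\<real>\<^sup>J\<close>, for \<open>f\<close> differentiable at \<open>w\<close>;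
  the gradient is the vector of partial derivatives.\<close>

definition linearization ::
    "'j set \<Rightarrow> (('j \<Rightarrow> real) \<Rightarrow> real) \<Rightarrow> ('j \<Rightarrow> real) \<Rightarrow> ('j \<Rightarrow> real) \<Rightarrow> real" where
  "linearization J f w x =
     f w + (\<Sum>j\<in>J. deriv (\<lambda>s. f (w(j := s))) (w j) * (x j - w j))"

text \<open>
  The coordinates of \<open>\<real>\<^sup>n\<^sup>+\<^sup>l\<close> are indexed by the sum type: \<open>Inl j\<close> is the coordinate \<open>x\<^sub>j\<close> and
  \<open>Inr i\<close> is the coordinate \<open>y\<^sub>i\<close>.  The \<open>i\<close>-th signomial term has the exponent vector \<open>\<alpha> i\<close>.
\<close>

definition signomial_lift ::
    "('l::finite \<Rightarrow> real ^ 'n::finite) \<Rightarrow> (real ^ ('n + 'l)) set" where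
  "signomial_lift \<alpha> =
     {z. (\<forall>p. 0 < z $ p) \<and>
         (\<forall>i. z $ Inr i = signomial_term UNIV (\<lambda>j. \<alpha> i $ j) (\<lambda>j. z $ Inl j))}"

text \<open>
  For the term \<open>x\<^sup>a\<close> and \<open>t = y\<^sub>i\<close>: \<open>U\<close>, \<open>V\<close> are the labels of the variables \<open>u\<close>, \<open>v\<close>, and the
  exponents \<open>\<beta>\<close>, \<open>\<gamma>\<close> matter on \<open>U\<close> and \<open>V\<close> only.  In the hypograph formulation
  \<open>u = (t, x\<^sub>-)\<close>, \<open>\<beta> = \<mu> (1, -a\<^sub>-)\<close>, \<open>v = x\<^sub>+\<close> and \<open>\<gamma> = \<mu> a\<^sub>+\<close>; in the epigraph formulation
  the roles are exchanged.
\<close>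

definition hypograph_dcc ::
    "real ^ 'n::finite \<Rightarrow> 'l::finite \<Rightarrow> real \<Rightarrow>
     ('n + 'l) set \<Rightarrow> ('n + 'l \<Rightarrow> real) \<Rightarrow> ('n + 'l) set \<Rightarrow> ('n + 'l \<Rightarrow> real) \<Rightarrow> bool" where
  "hypograph_dcc a i \<mu> U \<beta> V \<gamma> \<longleftrightarrow>
     U = insert (Inr i) (Inl ` {j. a $ j < 0}) \<and>
     V = Inl ` {j. a $ j > 0} \<and>
     \<beta> (Inr i) = \<mu> \<and>
     (\<forall>j. a $ j < 0 \<longrightarrow> \<beta> (Inl j) = \<mu> * (- (a $ j))) \<and>
     (\<forall>j. a $ j > 0 \<longrightarrow> \<gamma> (Inl j) = \<mu> * a $ j)"

definition epigraph_dcc ::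
    "real ^ 'n::finite \<Rightarrow> 'l::finite \<Rightarrow> real \<Rightarrow>
     ('n + 'l) set \<Rightarrow> ('n + 'l \<Rightarrow> real) \<Rightarrow> ('n + 'l) set \<Rightarrow> ('n + 'l \<Rightarrow> real) \<Rightarrow> bool" where
  "epigraph_dcc a i \<mu> U \<beta> V \<gamma> \<longleftrightarrow> hypograph_dcc a i \<mu> V \<gamma> U \<beta>"

definition normalized_dcc ::
    "real ^ 'n::finite \<Rightarrow> 'l::finite \<Rightarrow>
     ('n + 'l) set \<Rightarrow> ('n + 'l \<Rightarrow> real) \<Rightarrow> ('n + 'l) set \<Rightarrow> ('n + 'l \<Rightarrow> real) \<Rightarrow> bool" where
  "normalized_dcc a i U \<beta> V \<gamma> \<longleftrightarrow>
     (\<exists>\<mu>>0. hypograph_dcc a i \<mu> U \<beta> V \<gamma> \<or> epigraph_dcc a i \<mu> U \<beta> V \<gamma>) \<and>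
     max (l1_norm U \<beta>) (l1_norm V \<gamma>) = 1"

definition dcc_free_set ::
    "'p set \<Rightarrow> ('p \<Rightarrow> real) \<Rightarrow> 'p set \<Rightarrow> ('p \<Rightarrow> real) \<Rightarrow> ('p \<Rightarrow> real) \<Rightarrow>
     (('p \<Rightarrow> real) \<times> ('p \<Rightarrow> real)) set" where
  "dcc_free_set U \<beta> V \<gamma> w =
     {(u, v). u \<in> U \<rightarrow>\<^sub>E {0..} \<and> v \<in> V \<rightarrow>\<^sub>E UNIV \<and>
        signomial_term U \<beta> u - linearization V (signomial_term V \<gamma>) w v \<ge> 0}"

text \<open>The coordinates with a label outside \<open>U \<union> V\<close> are unrestricted.\<close>

definition orthogonal_lifting ::
    "'p::finite set \<Rightarrow> 'p set \<Rightarrow> (('p \<Rightarrow> real) \<times> ('p \<Rightarrow> real)) set \<Rightarrow> (real ^ 'p) set" where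
  "orthogonal_lifting U V C =
     {z. (restrict (\<lambda>p. z $ p) U, restrict (\<lambda>p. z $ p) V) \<in> C}"

definition nonneg_orthant :: "(real ^ 'p::finite) set" where
  "nonneg_orthant = {z. \<forall>p. 0 \<le> z $ p}"

text \<open>The standing requirements on \<open>S\<close> and \<open>G\<close> are part of the next two notions.\<close>

definition free_set :: "'a::euclidean_space set \<Rightarrow> 'a set \<Rightarrow> bool" where
  "free_set S C \<longleftrightarrow> S \<subset> UNIV \<and> closed C \<and> convex C \<and> interior C \<inter> S = {}"

definition maximal_free_set_in ::
    "'a::euclidean_space set \<Rightarrow> 'a set \<Rightarrow> 'a set \<Rightarrow> bool" where
  "maximal_free_set_in S G C \<longleftrightarrow>
     closed G \<and> convex G \<and> S \<subset> G \<and> free_set S C \<and>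
     \<not> (\<exists>C'. free_set S C' \<and> C \<inter> G \<subset> C' \<inter> G)"

end

theory Submission
  imports Defs
begin

text \<open>
  Weighted AM-GM, available because both exponent vectors have norm at most 1, makes \<open>\<psi>\<^sub>\<beta>\<close> concave
  and puts \<open>\<psi>\<^sub>\<gamma>\<close> below its linearization \<open>\<Xi>\<close>; hence \<open>\<psi>\<^sub>\<beta>(u) \<ge> \<Xi>(v)\<close> is convex and free.
  For maximality, let a larger free set contain a point \<open>(u, v)\<close> with \<open>\<psi>\<^sub>\<beta>(u) < \<Xi>(v)\<close>; we may
  take it positive.  As one of \<open>\<psi>\<^sub>\<beta>\<close>, \<open>\<psi>\<^sub>\<gamma>\<close> is homogeneous of degree 1, there is a point
  \<open>(\<kappa> u, \<nu> w)\<close> with \<open>\<psi>\<^sub>\<beta> = \<psi>\<^sub>\<gamma> = \<Xi>\<close> such that \<open>\<psi>\<^sub>\<beta>\<close> is affine on the ray from \<open>u\<close> through \<open>\<kappa> u\<close>: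
  either \<open>\<kappa> = 1\<close>, or \<open>\<psi>\<^sub>\<beta>\<close> has degree 1.  Beyond that point the ray satisfies \<open>\<psi>\<^sub>\<beta> > \<Xi>\<close>, so the
  point, which extends to one of the lift, is interior to the larger set.
\<close>

section \<open>Signomial terms, their linearizations, and weighted AM-GM\<close>

lemma signomial_term_pos:
  assumes "finite J" "\<And>j. j \<in> J \<Longrightarrow> 0 < v j"
  shows "0 < signomial_term J a v"
  unfolding signomial_term_def by (rule prod_pos) (use assms in force)

lemma signomial_term_nonneg: "0 \<le> signomial_term J a v"
  unfolding signomial_term_def by (rule prod_nonneg) simp

text \<open>\<open>0 powr r = 0\<close> for every real \<open>r\<close>, so exponents of any sign
  are covered.\<close>

lemma signomial_term_eq_0:
  assumes "finite J" "j \<in> J" "v j = 0"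
  shows "signomial_term J a v = 0"
  unfolding signomial_term_def using assms by (intro prod_zero) auto

lemma signomial_term_cong:
  assumes "\<And>j. j \<in> J \<Longrightarrow> a j = b j" "\<And>j. j \<in> J \<Longrightarrow> v j = v' j"
  shows "signomial_term J a v = signomial_term J b v'"
  unfolding signomial_term_def using assms by (intro prod.cong) auto

lemma ln_signomial_term:
  assumes "\<And>j. j \<in> J \<Longrightarrow> 0 < v j"
  shows "ln (signomial_term J a v) = (\<Sum>j\<in>J. a j * ln (v j))"
proof (cases "finite J")
  case True
  show ?thesis unfolding signomial_term_def
    using True assms by (subst ln_prod) (force simp: ln_powr)+
qed (simp add: signomial_term_def)

lemma signomial_term_scale:
  assumes "finite J" "0 < \<kappa>"
  shows "signomial_term J a (\<lambda>j. \<kappa> * v j) = \<kappa> powr sum a J * signomial_term J a v"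
proof -
  have "(\<kappa> * x) powr r = \<kappa> powr r * x powr r" for x r :: real
    using assms(2) by (simp add: powr_mult)
  then show ?thesis
    unfolding signomial_term_def using assms by (simp add: prod.distrib powr_sum)
qed

text \<open>The logarithmic partial derivatives are \<open>a j / w j\<close>, so the tangent becomes
  a weighted sum of relative changes, the form in which AM-GM applies.\<close>

lemma linearization_signomial_term:
  assumes J: "finite J" and w: "\<And>j. j \<in> J \<Longrightarrow> 0 < w j"
  shows "linearization J (signomial_term J a) w v =
    signomial_term J a w * (1 + (\<Sum>j\<in>J. a j * (v j / w j - 1)))"
proof -
  have "deriv (\<lambda>s. signomial_term J a (w(j := s))) (w j) = signomial_term J a w * (a j / w j)"
    if j: "j \<in> J" for j
  proof -
    let ?R = "\<Prod>k\<in>J - {j}. w k powr a k"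
    have "(\<Prod>k\<in>J - {j}. (w(j := s)) k powr a k) = ?R" for s
      by (rule prod.cong) auto
    then have split: "signomial_term J a (w(j := s)) = s powr a j * ?R" for s
      unfolding signomial_term_def using J j by (simp add: prod.remove[of J j])
    have "((\<lambda>s. s powr a j * ?R) has_real_derivative (a j * w j powr (a j - 1)) * ?R) (at (w j))"
      using w[OF j] by (auto intro!: derivative_eq_intros)
    then have "deriv (\<lambda>s. s powr a j * ?R) (w j) = (a j * w j powr (a j - 1)) * ?R"
      by (rule DERIV_imp_deriv)
    also have "\<dots> = (w j powr a j * ?R) * (a j / w j)"
      using w[OF j] by (simp add: powr_diff)
    also have "w j powr a j * ?R = signomial_term J a w"
      using split[of "w j"] by simp
    finally show ?thesis
      by (simp add: split)
  qed
  then have "linearization J (signomial_term J a) w v =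
      signomial_term J a w + (\<Sum>j\<in>J. signomial_term J a w * (a j / w j) * (v j - w j))"
    unfolding linearization_def by simp
  also have "(\<Sum>j\<in>J. signomial_term J a w * (a j / w j) * (v j - w j)) =
      (\<Sum>j\<in>J. signomial_term J a w * (a j * (v j / w j - 1)))"
  proof (rule sum.cong)
    fix j assume "j \<in> J"
    then have "w j \<noteq> 0" using w by force
    then show "signomial_term J a w * (a j / w j) * (v j - w j) =
        signomial_term J a w * (a j * (v j / w j - 1))"
      by (simp add: field_simps)
  qed simp
  finally show ?thesis
    by (simp add: sum_distrib_left distrib_left)
qed

text \<open>Weighted AM-GM for the ratios \<open>v\<^sub>j / w\<^sub>j\<close> and the number \<open>1\<close> with weight \<open>1 - \<Sum>a\<^sub>j\<close>.\<close>

lemma signomial_term_le_linearization: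
  assumes J: "finite J" and a: "\<And>j. j \<in> J \<Longrightarrow> 0 \<le> a j" and sum: "sum a J \<le> 1"
    and w: "\<And>j. j \<in> J \<Longrightarrow> 0 < w j" and v: "\<And>j. j \<in> J \<Longrightarrow> 0 \<le> v j"
  shows "signomial_term J a v \<le> linearization J (signomial_term J a) w v"
proof -
  define A where "A = 1 + (\<Sum>j\<in>J. a j * (v j / w j - 1))"
  have A_eq: "A = (1 - sum a J) + (\<Sum>j\<in>J. a j * (v j / w j))"
    unfolding A_def by (simp add: right_diff_distrib sum_subtractf)
  have quot_nonneg: "0 \<le> a j * (v j / w j)" if "j \<in> J" for j
    using a[OF that] v[OF that] w[OF that] by simp
  have A_nonneg: "0 \<le> A"
    unfolding A_eq using sum by (intro add_nonneg_nonneg sum_nonneg quot_nonneg) auto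
  have w_pos: "0 < signomial_term J a w"
    by (rule signomial_term_pos[OF J w])
  have "signomial_term J a v \<le> signomial_term J a w * A"
  proof (cases "\<exists>j\<in>J. v j = 0")
    case True
    then show ?thesis
      using signomial_term_eq_0[OF J] A_nonneg w_pos by (metis mult_nonneg_nonneg order_less_imp_le)
  next
    case False
    then have v: "0 < v j" if "j \<in> J" for j
      using v[OF that] that by force
    \<comment> \<open>If \<open>A\<close> vanished, both nonnegative parts would: the weights would
      sum to 1 although each of them is 0.\<close>
    have "A \<noteq> 0"
    proof
      assume "A = 0"
      moreover have "0 \<le> (\<Sum>j\<in>J. a j * (v j / w j))"
        by (intro sum_nonneg quot_nonneg)
      ultimately have "sum a J = 1" "(\<Sum>j\<in>J. a j * (v j / w j)) = 0"
        using sum by (auto simp: A_eq)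
      moreover have "a j = 0" if "j \<in> J" for j
        using \<open>(\<Sum>j\<in>J. a j * (v j / w j)) = 0\<close> that v[OF that] w[OF that]
        by (subst (asm) sum_nonneg_eq_0_iff) (use J quot_nonneg in auto)
      ultimately show False by simp
    qed
    with A_nonneg have A: "0 < A" by simp
    \<comment> \<open>The tangent of \<open>ln\<close> at the mean \<open>A\<close> yields Jensen's
      inequality. The vanishing term with \<open>ln 1\<close> below brings the total weight to 1, so
      the tangents add up to \<open>ln A\<close>.\<close>
    have ln_le: "ln x \<le> ln A + (x / A - 1)" if "0 < x" for x
      using ln_le_minus_one[of "x / A"] that A by (simp add: ln_div)
    have "a j * ln (v j / w j) = a j * ln (v j) - a j * ln (w j)" if "j \<in> J" for j
      using v[OF that] w[OF that] by (simp add: ln_div right_diff_distrib)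
    then have "ln (signomial_term J a v) - ln (signomial_term J a w)
        = (\<Sum>j\<in>J. a j * ln (v j / w j)) + (1 - sum a J) * ln 1"
      using v w by (simp add: ln_signomial_term sum_subtractf)
    also have "\<dots> \<le> (\<Sum>j\<in>J. a j * (ln A + ((v j / w j) / A - 1)))
        + (1 - sum a J) * (ln A + (1 / A - 1))"
      using sum v w by (intro add_mono sum_mono mult_left_mono ln_le a) auto
    also have "(\<Sum>j\<in>J. a j * (ln A + ((v j / w j) / A - 1)))
        = sum a J * (ln A - 1) + (\<Sum>j\<in>J. a j * (v j / w j)) / A"
      unfolding sum_distrib_right sum_divide_distrib sum.distrib[symmetric]
      by (intro sum.cong) (simp_all add: algebra_simps)
    also have "\<dots> + (1 - sum a J) * (ln A + (1 / A - 1)) = ln A - 1 + A / A"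
      unfolding A_eq[symmetric]
      by (subst (3) A_eq) (simp add: add_divide_distrib algebra_simps diff_divide_distrib)
    also have "\<dots> = ln A" using A by simp
    finally have "ln (signomial_term J a v) \<le> ln (signomial_term J a w * A)"
      using w_pos A by (simp add: ln_mult)
    then show ?thesis
      using w_pos A signomial_term_pos[OF J v] by (simp add: mult_pos_pos)
  qed
  then show ?thesis
    by (simp add: linearization_signomial_term[OF J w] A_def)
qed

lemma linearization_affine:
  "linearization J f w (\<lambda>j. (1 - t) * x j + t * y j) =
    (1 - t) * linearization J f w x + t * linearization J f w y"
proof -
  have "D * ((1 - t) * x j + t * y j - w j) = (1 - t) * (D * (x j - w j)) + t * (D * (y j - w j))"
    for D j by (simp add: algebra_simps)
  then show ?thesis
    unfolding linearization_def
    by (simp only: sum.distrib sum_distrib_left[symmetric]) (simp add: algebra_simps)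
qed

text \<open>Lets one small step length meet several open conditions at once.\<close>

lemma eventually_on_ray:
  fixes x d :: "'a::real_normed_vector"
  assumes "open W" "x \<in> W"
  shows "eventually (\<lambda>t. x + t *\<^sub>R d \<in> W) (at_right 0)"
proof -
  have "((\<lambda>t. x + t *\<^sub>R d) \<longlongrightarrow> x + 0 *\<^sub>R d) (at_right 0)"
    by (intro tendsto_intros)
  then show ?thesis
    using assms by (intro topological_tendstoD[where l = x]) simp_all
qed

lemma linearization_cong:
  "(\<And>j. j \<in> J \<Longrightarrow> x j = y j) \<Longrightarrow> linearization J f w x = linearization J f w y"
  unfolding linearization_def by (simp cong: sum.cong)

text \<open>The tangent at the intermediate point bounds both end values and is affine. If a
  coordinate of that point vanishes, no tangent is available, but then both end points vanish there
  too and all terms are 0.\<close>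

lemma signomial_term_concave:
  assumes J: "finite J" and a: "\<And>j. j \<in> J \<Longrightarrow> 0 < a j" and sum: "sum a J \<le> 1"
    and x: "\<And>j. j \<in> J \<Longrightarrow> 0 \<le> x j" and y: "\<And>j. j \<in> J \<Longrightarrow> 0 \<le> y j"
    and t: "0 < t" "t < 1"
  shows "(1 - t) * signomial_term J a x + t * signomial_term J a y
    \<le> signomial_term J a (\<lambda>j. (1 - t) * x j + t * y j)"
proof -
  let ?z = "\<lambda>j. (1 - t) * x j + t * y j"
  have z: "0 \<le> ?z j" if "j \<in> J" for j
    using x[OF that] y[OF that] t by simp
  show ?thesis
  proof (cases "\<exists>j\<in>J. ?z j = 0")
    case True
    then obtain j where j: "j \<in> J" "?z j = 0" by blast
    then have "(1 - t) * x j = 0" "t * y j = 0"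
      using x[OF j(1)] y[OF j(1)] t by (simp_all add: add_nonneg_eq_0_iff)
    then have "x j = 0" "y j = 0" using t by auto
    then show ?thesis
      using signomial_term_eq_0[OF J j(1)] signomial_term_nonneg by simp
  next
    case False
    then have pos: "0 < ?z j" if "j \<in> J" for j
      using z[OF that] that by (metis order_less_le)
    have a': "0 \<le> a j" if "j \<in> J" for j using a[OF that] by simp
    let ?L = "linearization J (signomial_term J a) ?z"
    have "(1 - t) * signomial_term J a x + t * signomial_term J a y \<le> (1 - t) * ?L x + t * ?L y"
      using t
      by (intro add_mono mult_left_mono signomial_term_le_linearization J a' sum pos x y) auto
    also have "\<dots> = ?L ?z" by (rule linearization_affine[symmetric])
    also have "\<dots> = signomial_term J a ?z" by (simp add: linearization_def)
    finally show ?thesis .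
  qed
qed

section \<open>The set \<open>C\<close> for an abstract normalized pair of exponent vectors\<close>

text \<open>Common ground of the hypograph and the epigraph formulation: for positive exponents, the
  normalization says exactly that both sums are at most 1 and one of them equals 1.\<close>

locale normalized_pair =
  fixes U V :: "'p::finite set" and \<beta> \<gamma> w :: "'p \<Rightarrow> real"
  assumes disjoint: "U \<inter> V = {}"
    and \<beta>_pos: "\<And>p. p \<in> U \<Longrightarrow> 0 < \<beta> p" and \<gamma>_pos: "\<And>p. p \<in> V \<Longrightarrow> 0 < \<gamma> p"
    and w_pos: "\<And>p. p \<in> V \<Longrightarrow> 0 < w p"
    and sum_\<beta>: "sum \<beta> U \<le> 1" and sum_\<gamma>: "sum \<gamma> V \<le> 1"
    and sum_eq_1: "sum \<beta> U = 1 \<or> sum \<gamma> V = 1"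
begin

text \<open>Clipping at \<open>0\<close> makes \<open>\<psi>\<^sub>\<beta>\<close> continuous on the whole space.\<close>

definition F :: "real ^ 'p \<Rightarrow> real" where
  "F z = signomial_term U \<beta> (\<lambda>p. max 0 (z $ p))"

definition G :: "real ^ 'p \<Rightarrow> real" where
  "G z = signomial_term V \<gamma> (\<lambda>p. z $ p)"

definition L :: "real ^ 'p \<Rightarrow> real" where
  "L z = linearization V (signomial_term V \<gamma>) w (\<lambda>p. z $ p)"

definition C :: "(real ^ 'p) set" where
  "C = {z. (\<forall>p\<in>U. 0 \<le> z $ p) \<and> L z \<le> F z}"

lemma F_eq: "(\<And>p. p \<in> U \<Longrightarrow> 0 \<le> z $ p) \<Longrightarrow> F z = signomial_term U \<beta> (\<lambda>p. z $ p)"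
  unfolding F_def by (rule signomial_term_cong) auto

lemma F_pos: "(\<And>p. p \<in> U \<Longrightarrow> 0 < z $ p) \<Longrightarrow> 0 < F z"
  unfolding F_def by (rule signomial_term_pos) auto

lemma F_scale:
  assumes z: "\<And>p. p \<in> U \<Longrightarrow> 0 < z $ p" and \<kappa>: "0 < \<kappa>"
    and y: "\<And>p. p \<in> U \<Longrightarrow> y $ p = \<kappa> * z $ p"
  shows "F y = \<kappa> powr sum \<beta> U * F z"
proof -
  have "F y = signomial_term U \<beta> (\<lambda>p. \<kappa> * max 0 (z $ p))"
    unfolding F_def using z \<kappa> by (intro signomial_term_cong) (simp_all add: y less_imp_le)
  then show ?thesis
    unfolding F_def using \<kappa> by (simp add: signomial_term_scale)
qed

lemma orthogonal_lifting_eq: "orthogonal_lifting U V (dcc_free_set U \<beta> V \<gamma> w) = C"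
proof -
  have "signomial_term U \<beta> (restrict (\<lambda>p. z $ p) U) = F z" if "\<forall>p\<in>U. 0 \<le> z $ p" for z
    using that by (subst F_eq) (auto intro!: signomial_term_cong)
  moreover have "linearization V (signomial_term V \<gamma>) w (restrict (\<lambda>p. z $ p) V) = L z" for z
    unfolding L_def by (rule linearization_cong) simp
  ultimately show ?thesis
    unfolding orthogonal_lifting_def dcc_free_set_def C_def by (auto simp: Pi_iff)
qed

lemma continuous_F: "continuous_on UNIV F"
  unfolding F_def signomial_term_def
  \<comment> \<open>Positive exponents give continuity of \<open>powr\<close> where the clipped base
    is 0.\<close>
  by (intro continuous_on_prod continuous_on_powr' continuous_intros ballI) (auto dest: \<beta>_pos)

lemma continuous_L: "continuous_on UNIV L"
  unfolding L_def linearization_def by (intro continuous_intros)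

lemma closed_C: "closed C"
proof -
  have "C = (\<Inter>p\<in>U. {z. 0 \<le> z $ p}) \<inter> {z. L z \<le> F z}"
    unfolding C_def by auto
  also have "closed \<dots>"
    by (intro closed_Int closed_INT ballI closed_Collect_le continuous_F continuous_L
        continuous_intros)
  finally show ?thesis .
qed

lemma L_affine: "L ((1 - t) *\<^sub>R x + t *\<^sub>R y) = (1 - t) * L x + t * L y"
proof -
  have "(\<lambda>p. ((1 - t) *\<^sub>R x + t *\<^sub>R y) $ p) = (\<lambda>p. (1 - t) * x $ p + t * y $ p)"
    by (rule ext) simp
  then show ?thesis
    unfolding L_def by (simp only: linearization_affine)
qed

lemma convex_C: "convex C"
  unfolding convex_alt
proof (intro ballI allI impI)
  fix x y and t :: real
  assume x: "x \<in> C" and y: "y \<in> C" and t: "0 \<le> t \<and> t \<le> 1"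
  let ?z = "(1 - t) *\<^sub>R x + t *\<^sub>R y"
  show "?z \<in> C"
  proof (cases "t = 0 \<or> t = 1")
    case True
    then show ?thesis using x y by auto
  next
    case False
    with t have t: "0 < t" "t < 1" by auto
    have nonneg: "\<forall>p\<in>U. 0 \<le> x $ p" "\<forall>p\<in>U. 0 \<le> y $ p" and le: "L x \<le> F x" "L y \<le> F y"
      using x y by (auto simp: C_def)
    have z: "\<forall>p\<in>U. 0 \<le> ?z $ p"
      using nonneg t by simp
    have "L ?z \<le> (1 - t) * F x + t * F y"
      unfolding L_affine using le t by (intro add_mono mult_left_mono) auto
    also have "\<dots> \<le> F ?z"
      using nonneg z signomial_term_concave[of U \<beta> "\<lambda>p. x $ p" "\<lambda>p. y $ p" t] t \<beta>_pos sum_\<beta>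
      by (simp add: F_eq)
    finally show ?thesis
      using z by (simp add: C_def)
  qed
qed

section \<open>Freeness of \<open>C\<close>\<close>

lemma G_le_L: "(\<And>p. p \<in> V \<Longrightarrow> 0 \<le> z $ p) \<Longrightarrow> G z \<le> L z"
  unfolding G_def L_def
  by (intro signomial_term_le_linearization sum_\<gamma> w_pos) (auto intro: less_imp_le \<gamma>_pos)

text \<open>Separates the constant part, which vanishes if \<open>sum \<gamma> V = 1\<close>;
  \<open>L\<close> is then linear in \<open>v\<close>.\<close>

lemma L_eq:
  "L z = signomial_term V \<gamma> w * (1 - sum \<gamma> V + (\<Sum>p\<in>V. \<gamma> p * (z $ p / w p)))"
  unfolding L_def
  by (simp add: linearization_signomial_term w_pos right_diff_distrib sum_subtractf)

lemma signomial_w_pos: "0 < signomial_term V \<gamma> w"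
  by (intro signomial_term_pos w_pos) simp_all

text \<open>At a point with \<open>\<psi>\<^sub>\<beta>(u) = \<psi>\<^sub>\<gamma>(v)\<close>, shrinking \<open>u\<close> and enlarging \<open>v\<close> leaves the set.\<close>

lemma not_interior_C:
  assumes pos: "\<And>p. 0 < s $ p" and eq: "F s = G s"
  shows "s \<notin> interior C"
proof
  assume "s \<in> interior C"
  define d :: "real ^ 'p" where
    "d = (\<chi> p. if p \<in> U then - (s $ p) else if p \<in> V then s $ p else 0)"
  have "eventually (\<lambda>t. s + t *\<^sub>R d \<in> interior C \<and> t \<in> {0<..<1}) (at_right 0)"
    using \<open>s \<in> interior C\<close>
    by (intro eventually_conj eventually_on_ray open_interior eventually_at_right_real) simp_all
  from eventually_happens'[OF trivial_limit_at_right_real this]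
  obtain t where in_C: "s + t *\<^sub>R d \<in> interior C" and t: "0 < t" "t < 1"
    by auto
  let ?s = "s + t *\<^sub>R d"
  have sU: "?s $ p = (1 - t) * s $ p" if "p \<in> U" for p
    using that by (simp add: d_def algebra_simps)
  have sV: "?s $ p = (1 + t) * s $ p" if "p \<in> V" for p
    using that disjoint by (auto simp: d_def algebra_simps)
  have F': "F ?s = (1 - t) powr sum \<beta> U * F s"
    using pos t by (intro F_scale) (simp_all only: sU diff_gt_0_iff_gt)
  have F_pos: "0 < F s" by (rule F_pos) (rule pos)
  have sum_\<beta>_nonneg: "0 \<le> sum \<beta> U"
    using \<beta>_pos by (intro sum_nonneg) (simp add: less_imp_le)
  have F'_le: "F ?s \<le> F s"
    unfolding F' using t F_pos sum_\<beta>_nonneg powr_le1[of "sum \<beta> U" "1 - t"]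
    by (simp add: mult_le_cancel_right1)
  let ?A = "\<Sum>p\<in>V. \<gamma> p * (s $ p / w p)"
  have "(\<Sum>p\<in>V. \<gamma> p * (?s $ p / w p)) = (\<Sum>p\<in>V. (1 + t) * (\<gamma> p * (s $ p / w p)))"
    by (intro sum.cong refl) (simp only: sV mult.left_commute times_divide_eq_right)
  also have "\<dots> = (1 + t) * ?A"
    by (simp only: sum_distrib_left)
  finally have L': "L ?s = L s + signomial_term V \<gamma> w * (t * ?A)"
    unfolding L_eq by (simp add: algebra_simps)
  have "0 \<le> ?A"
    using pos \<gamma>_pos w_pos by (intro sum_nonneg) (simp add: less_imp_le)
  then have L'_ge: "L s \<le> L ?s"
    unfolding L' using t signomial_w_pos by simp
  have "G s \<le> L s"
    using pos by (intro G_le_L) (simp add: less_imp_le)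
  with eq have F_le_L: "F s \<le> L s" by simp
  have "F ?s < L ?s"
  \<comment> \<open>The side of degree 1 gives strictness: either \<open>F\<close> shrinks by the
    factor \<open>1 - t\<close>, or \<open>L\<close> grows by the factor
    \<open>1 + t\<close>.\<close>
  proof (cases "sum \<beta> U = 1")
    case True
    then have "F ?s < F s" using F' F_pos t by simp
    with F_le_L L'_ge show ?thesis by simp
  next
    case False
    with sum_eq_1 have "L s = signomial_term V \<gamma> w * ?A"
      by (simp add: L_eq)
    then have "L ?s = L s + t * L s"
      unfolding L' by simp
    moreover have "0 < L s" using F_pos F_le_L by simp
    ultimately have "L s < L ?s" using t by simp
    with F_le_L F'_le show ?thesis by simp
  qed
  moreover have "L ?s \<le> F ?s"
    using in_C interior_subset by (fastforce simp: C_def)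
  ultimately show False by simp
qed

section \<open>Touching points and maximality\<close>

text \<open>The set touches \<open>\<psi>\<^sub>\<beta>(u) = \<psi>\<^sub>\<gamma>(v)\<close> over the ray through \<open>w\<close> if \<open>\<psi>\<^sub>\<gamma>\<close> is homogeneous of
  degree 1, and over \<open>w\<close> itself otherwise.\<close>

lemma touching_point:
  assumes "\<And>p. p \<in> U \<Longrightarrow> 0 < z $ p"
  obtains \<kappa> \<nu> where "0 < \<kappa>" "0 < \<nu>" "\<kappa> = 1 \<or> sum \<beta> U = 1"
    "\<And>q. (\<And>p. p \<in> U \<Longrightarrow> q $ p = \<kappa> * z $ p) \<Longrightarrow> (\<And>p. p \<in> V \<Longrightarrow> q $ p = \<nu> * w p) \<Longrightarrow>
      F q = G q \<and> L q = G q"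
proof -
  let ?c = "signomial_term V \<gamma> w"
  have F_pos: "0 < F z" by (rule F_pos) (rule assms)
  have G_q: "G q = \<nu> powr sum \<gamma> V * ?c" if "0 < \<nu>" "\<And>p. p \<in> V \<Longrightarrow> q $ p = \<nu> * w p" for q \<nu>
  proof -
    have "G q = signomial_term V \<gamma> (\<lambda>p. \<nu> * w p)"
      unfolding G_def by (intro signomial_term_cong) (simp_all add: that)
    also have "\<dots> = \<nu> powr sum \<gamma> V * ?c"
      using that by (intro signomial_term_scale) simp_all
    finally show ?thesis .
  qed
  have L_q: "L q = ?c * (1 - sum \<gamma> V + \<nu> * sum \<gamma> V)" if "\<And>p. p \<in> V \<Longrightarrow> q $ p = \<nu> * w p" for q \<nu>
  proof -
    have "(\<Sum>p\<in>V. \<gamma> p * (q $ p / w p)) = (\<Sum>p\<in>V. \<nu> * \<gamma> p)"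
      using w_pos by (intro sum.cong) (auto simp: that less_imp_neq[THEN not_sym])
    then show ?thesis
      unfolding L_eq by (simp only: sum_distrib_left)
  qed
  show ?thesis
  proof (cases "sum \<gamma> V = 1")
    case True
    \<comment> \<open>Along the ray through \<open>w\<close>, both \<open>G\<close> and
      \<open>L\<close> equal \<open>\<nu> * ?c\<close>; \<open>\<nu>\<close> is chosen to reach the
      value \<open>F z\<close>.\<close>
    have "0 < F z / ?c" using F_pos signomial_w_pos by simp
    show ?thesis
    proof (rule that[of 1 "F z / ?c"])
      fix q assume "\<And>p. p \<in> U \<Longrightarrow> q $ p = 1 * z $ p" "\<And>p. p \<in> V \<Longrightarrow> q $ p = F z / ?c * w p"
      note q = F_scale[OF assms zero_less_one this(1)]
        G_q[OF \<open>0 < F z / ?c\<close> this(2)] L_q[OF this(2)]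
      show "F q = G q \<and> L q = G q"
        using F_pos signomial_w_pos by (simp add: q True)
    qed (use \<open>0 < F z / ?c\<close> in simp_all)
  next
    case False
    with sum_eq_1 have sum: "sum \<beta> U = 1" by blast
    \<comment> \<open>At \<open>w\<close> itself \<open>G\<close> and \<open>L\<close> agree with
      \<open>?c\<close>; since \<open>F\<close> has degree 1, scaling \<open>u\<close> reaches this
      value.\<close>
    have "0 < ?c / F z" using F_pos signomial_w_pos by simp
    show ?thesis
    proof (rule that[of "?c / F z" 1])
      fix q assume "\<And>p. p \<in> U \<Longrightarrow> q $ p = ?c / F z * z $ p" "\<And>p. p \<in> V \<Longrightarrow> q $ p = 1 * w p"
      note q = F_scale[OF assms \<open>0 < ?c / F z\<close> this(1)]
        G_q[OF zero_less_one this(2)] L_q[OF this(2)]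
      show "F q = G q \<and> L q = G q"
        using F_pos signomial_w_pos by (simp add: q sum)
    qed (use \<open>0 < ?c / F z\<close> sum in simp_all)
  qed
qed

lemma open_pos: "open {z :: real ^ 'p. \<forall>p. 0 < z $ p}"
proof -
  have "{z :: real ^ 'p. \<forall>p. 0 < z $ p} = (\<Inter>p. {z. 0 < z $ p})" by auto
  also have "open \<dots>"
    by (intro open_INT ballI open_Collect_less continuous_intros) simp
  finally show ?thesis .
qed

text \<open>Provides a target for pushing boundary points of the orthant into its interior.\<close>

lemma positive_point_C: obtains x where "x \<in> C" "\<And>p. 0 < x $ p"
proof -
  obtain \<kappa> \<nu> where \<kappa>: "0 < \<kappa>" and \<nu>: "0 < \<nu>" and
    touch: "\<And>q. (\<And>p. p \<in> U \<Longrightarrow> q $ p = \<kappa> * (1 :: real ^ 'p) $ p) \<Longrightarrow>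
      (\<And>p. p \<in> V \<Longrightarrow> q $ p = \<nu> * w p) \<Longrightarrow> F q = G q \<and> L q = G q"
    using touching_point[of 1] by (metis one_index zero_less_one)
  define x :: "real ^ 'p" where "x = (\<chi> p. if p \<in> V then \<nu> * w p else \<kappa>)"
  have pos: "0 < x $ p" for p
    using \<kappa> \<nu> w_pos by (simp add: x_def)
  have "F x = G x \<and> L x = G x"
    using disjoint by (intro touch) (auto simp: x_def)
  then have "x \<in> C"
    using pos by (simp add: C_def less_imp_le)
  with pos that show ?thesis by blast
qed

text \<open>\<open>S_extend\<close> says that every positive solution of \<open>F = G\<close> is met
  by \<open>S\<close> in the coordinates \<open>U \<union> V\<close>, the only ones on which
  \<open>F\<close>, \<open>G\<close> and \<open>L\<close> depend.\<close>

lemma maximal_free_set_in_C: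
  assumes S_pos: "\<And>s p. s \<in> S \<Longrightarrow> 0 < s $ p" and S_eq: "\<And>s. s \<in> S \<Longrightarrow> F s = G s"
    and S_extend: "\<And>q. (\<And>p. 0 < q $ p) \<Longrightarrow> F q = G q \<Longrightarrow> \<exists>s\<in>S. \<forall>p\<in>U \<union> V. s $ p = q $ p"
  shows "maximal_free_set_in S nonneg_orthant C"
proof -
  have orthant: "nonneg_orthant = (\<Inter>p. {z :: real ^ 'p. 0 \<le> z $ p})"
    by (auto simp: nonneg_orthant_def)
  have "closed (nonneg_orthant :: (real ^ 'p) set)"
    unfolding orthant by (intro closed_INT ballI closed_Collect_le continuous_intros)
  moreover have "convex (nonneg_orthant :: (real ^ 'p) set)"
    by (auto simp: convex_def nonneg_orthant_def)
  moreover have zero: "0 \<notin> S" using S_pos by fastforce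
  then have "S \<subset> nonneg_orthant"
    using S_pos by (auto simp: nonneg_orthant_def less_imp_le intro!: psubsetI)
  moreover have "free_set S C"
    unfolding free_set_def using zero closed_C convex_C not_interior_C S_pos S_eq by blast
  moreover have False if free: "free_set S C'" and sub: "C \<inter> nonneg_orthant \<subset> C' \<inter> nonneg_orthant"
    for C'
  proof -
    have C': "convex C'" "interior C' \<inter> S = {}" using free by (auto simp: free_set_def)
    obtain z0 where z0: "z0 \<in> C'" "z0 \<in> nonneg_orthant" "z0 \<notin> C" using sub by blast
    then have z0_lt: "F z0 < L z0" and z0_nonneg: "0 \<le> z0 $ p" for p
      by (auto simp: C_def nonneg_orthant_def not_le)
    obtain x where x: "x \<in> C" "\<And>p. 0 < x $ p" using positive_point_C by blast
    then have "x \<in> C'" using sub by (auto simp: nonneg_orthant_def less_imp_le)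
    \<comment> \<open>A short move from \<open>z0\<close> towards \<open>x\<close> makes all
      coordinates positive, stays in \<open>C'\<close> by convexity, and keeps the open condition
      \<open>F < L\<close>.\<close>
    obtain z where z: "z \<in> C'" "\<And>p. 0 < z $ p" "F z < L z"
    proof -
      have op: "open {y. F y < L y}"
        by (intro open_Collect_less continuous_F continuous_L)
      have "eventually (\<lambda>t. z0 + t *\<^sub>R (x - z0) \<in> {y. F y < L y} \<and> t \<in> {0<..<1}) (at_right 0)"
        using z0_lt by (intro eventually_conj eventually_on_ray op eventually_at_right_real) simp_all
      from eventually_happens'[OF trivial_limit_at_right_real this]
      obtain t where "z0 + t *\<^sub>R (x - z0) \<in> {y. F y < L y}" and t: "0 < t" "t < 1"
        by auto
      moreover have "z0 + t *\<^sub>R (x - z0) = (1 - t) *\<^sub>R z0 + t *\<^sub>R x"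
        by (simp add: algebra_simps)
      ultimately have lt: "F ((1 - t) *\<^sub>R z0 + t *\<^sub>R x) < L ((1 - t) *\<^sub>R z0 + t *\<^sub>R x)"
        by simp
      show ?thesis
      proof (rule that)
        show "(1 - t) *\<^sub>R z0 + t *\<^sub>R x \<in> C'"
          using C'(1) z0(1) \<open>x \<in> C'\<close> t by (simp add: convex_alt)
        show "0 < ((1 - t) *\<^sub>R z0 + t *\<^sub>R x) $ p" for p
          using z0_nonneg[of p] x(2)[of p] t by (simp add: add_nonneg_pos)
      qed (rule lt)
    qed
    obtain \<kappa> \<nu> where \<kappa>: "0 < \<kappa>" "\<kappa> = 1 \<or> sum \<beta> U = 1" and \<nu>: "0 < \<nu>" and
      touch: "\<And>q. (\<And>p. p \<in> U \<Longrightarrow> q $ p = \<kappa> * z $ p) \<Longrightarrow>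
        (\<And>p. p \<in> V \<Longrightarrow> q $ p = \<nu> * w p) \<Longrightarrow> F q = G q \<and> L q = G q"
      using touching_point[of z] z(2) by metis
    define q0 :: "real ^ 'p" where "q0 = (\<chi> p. if p \<in> V then \<nu> * w p else \<kappa> * z $ p)"
    have q0_pos: "0 < q0 $ p" for p
      using \<kappa> \<nu> z(2) w_pos by (simp add: q0_def)
    have "F q0 = G q0 \<and> L q0 = G q0"
      using disjoint by (intro touch) (auto simp: q0_def)
    then obtain q where q: "q \<in> S" "\<forall>p\<in>U \<union> V. q $ p = q0 $ p"
      using S_extend[of q0] q0_pos by blast
    have qU: "q $ p = \<kappa> * z $ p" if "p \<in> U" for p
      using q(2) that disjoint by (auto simp: q0_def)
    have qV: "q $ p = \<nu> * w p" if "p \<in> V" for p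
      using q(2) that by (auto simp: q0_def)
    have F_q: "F q = L q" using touch[OF qU qV] by simp
    \<comment> \<open>Continue the segment from \<open>z\<close> to \<open>q\<close> slightly beyond
      \<open>q\<close>, keeping the coordinates and the scaling factor on \<open>U\<close>
      positive.\<close>
    have "eventually (\<lambda>t. q + t *\<^sub>R (q - z) \<in> {y. \<forall>p. 0 < y $ p} \<and>
        \<kappa> + t *\<^sub>R (\<kappa> - 1) \<in> {0<..} \<and> t \<in> {0<..<1}) (at_right 0)"
      using \<kappa>(1) S_pos[OF q(1)]
      by (intro eventually_conj eventually_on_ray open_pos open_greaterThan
          eventually_at_right_real) simp_all
    from eventually_happens'[OF trivial_limit_at_right_real this]
    obtain t where r_pos: "\<And>p. 0 < (q + t *\<^sub>R (q - z)) $ p" and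
      \<kappa>_t: "0 < \<kappa> + t * (\<kappa> - 1)" and t: "0 < t"
      by auto
    define r where "r = q + t *\<^sub>R (q - z)"
    have "r $ p = (\<kappa> + t * (\<kappa> - 1)) * z $ p" if "p \<in> U" for p
      using qU[OF that] by (simp add: r_def algebra_simps)
    then have "F r = (\<kappa> + t * (\<kappa> - 1)) powr sum \<beta> U * F z"
      using \<kappa>_t z(2) by (intro F_scale)
    moreover have "F q = \<kappa> powr sum \<beta> U * F z"
      using \<kappa>(1) z(2) qU by (intro F_scale)
    \<comment> \<open>For \<open>\<kappa> = 1\<close> all three values of \<open>F\<close> coincide;
      in degree 1, \<open>F\<close> is linear in the scaling factor.\<close>
    ultimately have F_r: "F r = (1 + t) * F q - t * F z"
      using \<kappa> \<kappa>_t by (auto simp: algebra_simps)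
    \<comment> \<open>\<open>L\<close> is affine for every real parameter, hence also for this
      extrapolation. As \<open>F q = L q\<close> and \<open>F z < L z\<close>, it falls below
      \<open>F\<close> at \<open>r\<close>.\<close>
    have "r = (1 - (- t)) *\<^sub>R q + (- t) *\<^sub>R z"
      by (simp add: r_def algebra_simps)
    then have "L r = (1 + t) * L q - t * L z"
      by (simp only: L_affine) simp
    also have "\<dots> < F r"
      unfolding F_r F_q using z(3) t by simp
    finally have "L r < F r" .
    let ?W = "{y. \<forall>p. 0 < y $ p} \<inter> {y. L y < F y}"
    have "open ?W"
      by (intro open_Int open_pos open_Collect_less continuous_F continuous_L)
    moreover have "?W \<subseteq> C \<inter> nonneg_orthant"
      by (auto simp: C_def nonneg_orthant_def less_imp_le)
    moreover have "r \<in> ?W"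
      using r_pos \<open>L r < F r\<close> by (simp add: r_def)
    ultimately have r_int: "r \<in> interior C'"
      using sub by (meson interior_maximal le_infE psubset_imp_subset subset_iff)
    \<comment> \<open>\<open>q\<close> lies strictly between \<open>z\<close> in \<open>C'\<close>
      and the interior point \<open>r\<close>, so it is interior as well.\<close>
    have "z - r = - ((1 + t) *\<^sub>R (q - z))"
      by (simp add: r_def algebra_simps)
    then have "q = z - (1 / (1 + t)) *\<^sub>R (z - r)"
      using t by simp
    moreover have "z - (1 / (1 + t)) *\<^sub>R (z - r) \<in> interior C'"
      using t by (intro mem_interior_convex_shrink C'(1) r_int z(1)) simp_all
    ultimately show False using C'(2) q(1) by auto
  qed
  ultimately show ?thesis
    unfolding maximal_free_set_in_def by blast
qed

end

section \<open>From the formulations of a signomial term to the abstract pair\<close>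

text \<open>For positive variables, logarithms turn both equations into linear ones; moving the
  negative exponents to the other side and multiplying by \<open>\<mu>\<close> links them. Zero
  exponents contribute nothing.\<close>

lemma hypograph_dcc_iff:
  fixes a :: "real ^ 'n::finite" and i :: "'l::finite" and z :: "'n + 'l \<Rightarrow> real"
  assumes dcc: "hypograph_dcc a i \<mu> U \<beta> V \<gamma>" and \<mu>: "0 < \<mu>" and z: "\<And>p. 0 < z p"
  shows "z (Inr i) = signomial_term UNIV (\<lambda>j. a $ j) (\<lambda>j. z (Inl j)) \<longleftrightarrow>
    signomial_term U \<beta> z = signomial_term V \<gamma> z"
proof -
  let ?N = "{j. a $ j < 0}" and ?P = "{j. 0 < a $ j}"
  let ?f = "\<lambda>j. a $ j * ln (z (Inl j))"
  have U: "U = insert (Inr i) (Inl ` ?N)" and V: "V = Inl ` ?P"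
    using dcc by (auto simp: hypograph_dcc_def)
  have "ln (signomial_term U \<beta> z) =
      \<beta> (Inr i) * ln (z (Inr i)) + (\<Sum>j\<in>?N. \<beta> (Inl j) * ln (z (Inl j)))"
    unfolding U using z by (subst ln_signomial_term) (auto simp: sum.reindex sum.insert_if)
  also have "\<dots> = \<mu> * ln (z (Inr i)) + (\<Sum>j\<in>?N. \<mu> * - ?f j)"
    using dcc by (auto simp: hypograph_dcc_def intro!: sum.cong)
  finally have "ln (signomial_term U \<beta> z) = \<mu> * ln (z (Inr i)) + (\<Sum>j\<in>?N. \<mu> * - ?f j)" .
  then have lnU: "ln (signomial_term U \<beta> z) = \<mu> * (ln (z (Inr i)) - sum ?f ?N)"
    by (simp only: sum_distrib_left[symmetric] sum_negf distrib_left) (simp add: algebra_simps)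
  have "ln (signomial_term V \<gamma> z) = (\<Sum>j\<in>?P. \<mu> * ?f j)"
    using dcc z by (auto simp: ln_signomial_term V sum.reindex hypograph_dcc_def intro!: sum.cong)
  then have lnV: "ln (signomial_term V \<gamma> z) = \<mu> * sum ?f ?P"
    by (simp only: sum_distrib_left[symmetric])
  have "sum ?f UNIV = sum ?f (?N \<union> ?P)"
    by (intro sum.mono_neutral_right) auto
  also have "\<dots> = sum ?f ?N + sum ?f ?P"
    by (intro sum.union_disjoint) auto
  finally have lnT: "ln (signomial_term UNIV (\<lambda>j. a $ j) (\<lambda>j. z (Inl j))) = sum ?f ?N + sum ?f ?P"
    using z by (simp add: ln_signomial_term)
  have "z (Inr i) = signomial_term UNIV (\<lambda>j. a $ j) (\<lambda>j. z (Inl j)) \<longleftrightarrow>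
      ln (z (Inr i)) = sum ?f ?N + sum ?f ?P"
    unfolding lnT[symmetric] using z by (intro ln_inj_iff[symmetric] signomial_term_pos) simp_all
  also have "\<dots> \<longleftrightarrow> ln (signomial_term U \<beta> z) = ln (signomial_term V \<gamma> z)"
    unfolding lnU lnV using \<mu> by auto
  also have "\<dots> \<longleftrightarrow> signomial_term U \<beta> z = signomial_term V \<gamma> z"
    using z by (intro ln_inj_iff signomial_term_pos) simp_all
  finally show ?thesis .
qed

lemma hypograph_dcc_labels:
  assumes "hypograph_dcc a i \<mu> U \<beta> V \<gamma>" and "0 < \<mu>"
  shows "U \<inter> V = {} \<and> U \<union> V \<subseteq> insert (Inr i) (range Inl) \<and>
    (\<forall>p\<in>U. 0 < \<beta> p) \<and> (\<forall>p\<in>V. 0 < \<gamma> p)"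
  using assms by (auto simp: hypograph_dcc_def mult_pos_neg)

theorem corollary1:
  fixes \<alpha> :: "'l::finite \<Rightarrow> real ^ 'n::finite"
    and i :: 'l
    and U V :: "('n + 'l) set"
    and \<beta> \<gamma> w :: "'n + 'l \<Rightarrow> real"
  assumes "normalized_dcc (\<alpha> i) i U \<beta> V \<gamma>"
    and "w \<in> V \<rightarrow>\<^sub>E {0<..}"
  shows "maximal_free_set_in (signomial_lift \<alpha>) nonneg_orthant
           (orthogonal_lifting U V (dcc_free_set U \<beta> V \<gamma> w))"
proof -
  obtain \<mu> where \<mu>: "0 < \<mu>" and
    dcc: "hypograph_dcc (\<alpha> i) i \<mu> U \<beta> V \<gamma> \<or> hypograph_dcc (\<alpha> i) i \<mu> V \<gamma> U \<beta>"
    and norm: "max (l1_norm U \<beta>) (l1_norm V \<gamma>) = 1"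
    using assms(1) by (auto simp: normalized_dcc_def epigraph_dcc_def)
  from dcc have "U \<inter> V = {} \<and> U \<union> V \<subseteq> insert (Inr i) (range Inl) \<and>
      (\<forall>p\<in>U. 0 < \<beta> p) \<and> (\<forall>p\<in>V. 0 < \<gamma> p)"
  proof
    assume "hypograph_dcc (\<alpha> i) i \<mu> U \<beta> V \<gamma>"
    from hypograph_dcc_labels[OF this \<mu>] show ?thesis .
  next
    assume "hypograph_dcc (\<alpha> i) i \<mu> V \<gamma> U \<beta>"
    from hypograph_dcc_labels[OF this \<mu>] show ?thesis by blast
  qed
  then have labels: "U \<inter> V = {}" "U \<union> V \<subseteq> insert (Inr i) (range Inl)"
      "\<And>p. p \<in> U \<Longrightarrow> 0 < \<beta> p" "\<And>p. p \<in> V \<Longrightarrow> 0 < \<gamma> p"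
    by blast+
  have "l1_norm U \<beta> = sum \<beta> U" "l1_norm V \<gamma> = sum \<gamma> V"
    unfolding l1_norm_def using labels(3,4) by (simp_all add: less_imp_le)
  then interpret normalized_pair U V \<beta> \<gamma> w
    using labels norm assms(2) by unfold_locales (auto simp: max_def split: if_splits)
  \<comment> \<open>The epigraph case is the hypograph case with the sides of the equation
    exchanged.\<close>
  have lift_iff: "z $ Inr i = signomial_term UNIV (\<lambda>j. \<alpha> i $ j) (\<lambda>j. z $ Inl j) \<longleftrightarrow> F z = G z"
    if "\<And>p. 0 < z $ p" for z :: "real ^ ('n + 'l)"
  proof -
    have "F z = signomial_term U \<beta> (\<lambda>p. z $ p)"
      using that by (intro F_eq) (simp add: less_imp_le)
    then show ?thesis
      unfolding G_def using dcc hypograph_dcc_iff[OF _ \<mu>, of _ _ _ _ _ _ "\<lambda>p. z $ p"] that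
      by metis
  qed
  have "maximal_free_set_in (signomial_lift \<alpha>) nonneg_orthant C"
  proof (rule maximal_free_set_in_C)
    show "0 < s $ p" if "s \<in> signomial_lift \<alpha>" for s p
      using that by (simp add: signomial_lift_def)
    show "F s = G s" if "s \<in> signomial_lift \<alpha>" for s
      using that lift_iff[of s] by (simp add: signomial_lift_def)
    fix q :: "real ^ ('n + 'l)"
    assume q: "\<And>p. 0 < q $ p" "F q = G q"
    \<comment> \<open>Keep the \<open>x\<close> part of \<open>q\<close> and recompute every
      \<open>y\<close> coordinate. By \<open>lift_iff\<close> the \<open>i\<close>-th one does not
      change, and \<open>U \<union> V\<close> contains no other \<open>y\<close> label.\<close>
    define s :: "real ^ ('n + 'l)" where
      "s = (\<chi> p. case p of Inl j \<Rightarrow> q $ Inl j |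
        Inr k \<Rightarrow> signomial_term UNIV (\<lambda>j. \<alpha> k $ j) (\<lambda>j. q $ Inl j))"
    have "s \<in> signomial_lift \<alpha>"
      using q(1) by (auto simp: signomial_lift_def s_def signomial_term_pos split: sum.split)
    moreover have "s $ Inr i = q $ Inr i"
      using lift_iff[OF q(1)] q(2) by (simp add: s_def)
    then have "\<forall>p\<in>U \<union> V. s $ p = q $ p"
      using labels(2) by (auto simp: s_def)
    ultimately show "\<exists>s\<in>signomial_lift \<alpha>. \<forall>p\<in>U \<union> V. s $ p = q $ p"
      by blast
  qed
  then show ?thesis
    by (simp only: orthogonal_lifting_eq)
qed

end
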